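(* Fix a measure $\pi_X$ and $Q_{UX}=Q_UQ_{X|U}$ with output $Q_X$ (with $Q_{X|U=u}\ll\pi_X$). Let $U^M=(U_1,\dots,U_M)$ be i.i.d. $Q_U$ and $Q_{X[c^M]}:=\frac1M\sum_{m=1}^MQ_{X|U=c_m}$. Then for every $\tau_0\ge0$, $\alpha\in\mathbb{R}$ and $\beta>1$, $$\mathbb{E}[D(Q_{X[U^M]}\|\pi_X)]\le\tau_0+\mathbb{E}\Big[\imath_{Q_{X|U}\|\pi_X}(X|U)-\tau_0-\log\frac M2\Big]^++\beta\,\mathbb{E}\big[\imath_{Q_X\|\pi_X}(X)-\tau_0+\alpha\big]^++\frac{2\beta}{\beta-1}\exp(-\alpha),$$ where $(U,X)\sim Q_UQ_{X|U}$.
   Context: $\imath_{Q_{X|U}\|\pi_X}(x|u):=\log\frac{dQ_{X|U=u}}{d\pi_X}(x)$, $\imath_{Q_X\|\pi_X}(x):=\log\frac{dQ_X}{d\pi_X}(x)$. $\mathbb{E}[A]^+$ means $\mathbb{E}[\max\{A,0\}]$. *)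

theory Defs
  imports "HOL-Probability.Probability"
begin

definition cond_out :: "'x measure \<Rightarrow> ('u \<Rightarrow> 'x \<Rightarrow> real) \<Rightarrow> 'u \<Rightarrow> 'x measure" where
  "cond_out piX q u = density piX (\<lambda>x. ennreal (q u x))"

definition out_dens :: "'u measure \<Rightarrow> ('u \<Rightarrow> 'x \<Rightarrow> real) \<Rightarrow> 'x \<Rightarrow> real" where
  "out_dens QU q x = enn2real (\<integral>\<^sup>+ u. ennreal (q u x) \<partial>QU)"

definition mix_dens :: "('u \<Rightarrow> 'x \<Rightarrow> real) \<Rightarrow> nat \<Rightarrow> (nat \<Rightarrow> 'u) \<Rightarrow> 'x \<Rightarrow> real" where
  "mix_dens q M c x = (\<Sum>m<M. q (c m) x) / real M"

definition mix_out :: "'x measure \<Rightarrow> ('u \<Rightarrow> 'x \<Rightarrow> real) \<Rightarrow> nat \<Rightarrow> (nat \<Rightarrow> 'u) \<Rightarrow> 'x measure" where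
  "mix_out piX q M c = density piX (\<lambda>x. ennreal (mix_dens q M c x))"

text \<open>Relative entropy D(P||pi) = int log (dP/dpi) dP of a measure P = density pi p, split into
  its positive part and negative part contributions (both in [0,\<infinity>]);
  D(P||pi) = rel_ent_pos - rel_ent_neg whenever this is well defined.\<close>
definition rel_ent_pos :: "'x measure \<Rightarrow> ('x \<Rightarrow> real) \<Rightarrow> ennreal" where
  "rel_ent_pos piX p = (\<integral>\<^sup>+ x. ennreal (max 0 (ln (p x))) \<partial>(density piX (\<lambda>x. ennreal (p x))))"

definition rel_ent_neg :: "'x measure \<Rightarrow> ('x \<Rightarrow> real) \<Rightarrow> ennreal" where
  "rel_ent_neg piX p = (\<integral>\<^sup>+ x. ennreal (max 0 (- ln (p x))) \<partial>(density piX (\<lambda>x. ennreal (p x))))"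

end

theory Submission
  imports Defs
begin

text \<open>Write the mixture density at \<open>x\<close> as \<open>(p + S) / M\<close>, where \<open>p\<close> is the density of the codeword that
  generated \<open>x\<close> and \<open>S\<close> the sum over the other codewords. If \<open>p\<close> dominates, the logarithm is at most
  \<open>ln p - ln (M / 2)\<close>; if \<open>S\<close> dominates, \<open>ln z \<le> z - 1\<close> after rescaling by \<open>exp L\<close>, with \<open>L\<close> the positive
  part of the shifted output information density, makes the bound linear in \<open>S\<close>. The expectation
  of the linear term is a collision integral of two independent codewords, at most \<open>2 exp (- \<alpha>)\<close> in total.

  The reference measure need not be sigma-finite, so the relative entropies may fail to be
  measurable in the codebook, and the integral of a nonmeasurable function is a lower integral.
  Lower integrals still satisfy one direction of Fubini's theorem, and they are subadditive when one of
  the summands is measurable; this is all that is needed.\<close>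

section \<open>Lower integrals of nonmeasurable functions\<close>

text \<open>For a simple \<open>s\<close> below \<open>f + h\<close>, the truncated difference
  \<open>s - h\<close> is measurable and lies below \<open>f\<close>, whatever \<open>f\<close>
  is.\<close>

lemma nn_integral_add_le:
  assumes h: "h \<in> borel_measurable N"
  shows "(\<integral>\<^sup>+ x. f x + h x \<partial>N) \<le> (\<integral>\<^sup>+ x. f x \<partial>N) + (\<integral>\<^sup>+ x. h x \<partial>N)"
proof -
  \<comment> \<open>Minorants with finite values are taken because \<open>top - top = top\<close> in
    \<open>ennreal\<close>, which would break the comparison of \<open>s - h\<close> with
    \<open>f\<close>.\<close>
  have "integral\<^sup>S N s \<le> (\<integral>\<^sup>+ x. f x \<partial>N) + (\<integral>\<^sup>+ x. h x \<partial>N)"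
    if s: "simple_function N s" and le: "s \<le> (\<lambda>x. f x + h x)" and fin: "\<forall>x. s x < top" for s
  proof -
    have [measurable]: "s \<in> borel_measurable N" "h \<in> borel_measurable N"
      using s h by (auto intro: borel_measurable_simple_function)
    have "integral\<^sup>S N s = (\<integral>\<^sup>+ x. s x \<partial>N)"
      using s by (simp add: nn_integral_eq_simple_integral)
    also have "\<dots> \<le> (\<integral>\<^sup>+ x. (s x - h x) + h x \<partial>N)"
      using ennreal_minus_le_iff[THEN iffD1, OF order_refl]
      by (intro nn_integral_mono) (simp add: add.commute)
    also have "\<dots> = (\<integral>\<^sup>+ x. s x - h x \<partial>N) + (\<integral>\<^sup>+ x. h x \<partial>N)"
      by (intro nn_integral_add) auto
    also have "(\<integral>\<^sup>+ x. s x - h x \<partial>N) \<le> (\<integral>\<^sup>+ x. f x \<partial>N)"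
      using le fin[THEN spec, THEN less_imp_neq]
      by (intro nn_integral_mono) (auto simp: ennreal_minus_le_iff le_fun_def add.commute)
    finally show ?thesis by simp
  qed
  then show ?thesis
    by (subst nn_integral_def_finite) (auto intro!: SUP_least)
qed

text \<open>Dividing a simple minorant of \<open>c * f\<close> by \<open>c\<close> gives a
  measurable minorant of \<open>f\<close>; strict positivity of \<open>c\<close> supplies the
  inverse.\<close>

lemma nn_integral_cmult_le:
  fixes c :: real
  assumes "c > 0"
  shows "(\<integral>\<^sup>+ x. ennreal c * f x \<partial>N) \<le> ennreal c * (\<integral>\<^sup>+ x. f x \<partial>N)"
proof -
  have inv: "ennreal c * (ennreal (1 / c) * z) = z" "ennreal (1 / c) * (ennreal c * z) = z" for z
    using assms by (simp_all add: mult.assoc[symmetric] ennreal_mult[symmetric])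
  have "integral\<^sup>S N s \<le> ennreal c * (\<integral>\<^sup>+ x. f x \<partial>N)"
    if s: "simple_function N s" and le: "s \<le> (\<lambda>x. ennreal c * f x)" for s
  proof -
    have [measurable]: "s \<in> borel_measurable N"
      using s by (rule borel_measurable_simple_function)
    have "integral\<^sup>S N s = (\<integral>\<^sup>+ x. ennreal c * (ennreal (1 / c) * s x) \<partial>N)"
      using s by (simp add: nn_integral_eq_simple_integral inv)
    also have "\<dots> = ennreal c * (\<integral>\<^sup>+ x. ennreal (1 / c) * s x \<partial>N)"
      by (intro nn_integral_cmult) auto
    also have "(\<integral>\<^sup>+ x. ennreal (1 / c) * s x \<partial>N) \<le> (\<integral>\<^sup>+ x. ennreal (1 / c) * (ennreal c * f x) \<partial>N)"
      using le by (intro nn_integral_mono mult_left_mono) (auto simp: le_fun_def)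
    finally show ?thesis by (simp add: inv mult_left_mono)
  qed
  then show ?thesis
    by (subst nn_integral_def) (auto intro!: SUP_least)
qed

section \<open>Integration over a random codebook\<close>

text \<open>Tonelli applies to each simple minorant of \<open>f\<close>, and the iterated integral
  of a minorant is below that of \<open>f\<close>.\<close>

lemma (in product_sigma_finite) nn_integral_PiM_insert_le:
  assumes "finite I" "i \<notin> I"
  shows "(\<integral>\<^sup>+ c. f c \<partial>Pi\<^sub>M (insert i I) M) \<le> (\<integral>\<^sup>+ v. \<integral>\<^sup>+ c. f (c(i := v)) \<partial>Pi\<^sub>M I M \<partial>M i)"
proof -
  have "integral\<^sup>S (Pi\<^sub>M (insert i I) M) s \<le> (\<integral>\<^sup>+ v. \<integral>\<^sup>+ c. f (c(i := v)) \<partial>Pi\<^sub>M I M \<partial>M i)"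
    if s: "simple_function (Pi\<^sub>M (insert i I) M) s" and le: "s \<le> f" for s
  proof -
    have "integral\<^sup>S (Pi\<^sub>M (insert i I) M) s = (\<integral>\<^sup>+ c. s c \<partial>Pi\<^sub>M (insert i I) M)"
      using s by (simp add: nn_integral_eq_simple_integral)
    also have "\<dots> = (\<integral>\<^sup>+ v. \<integral>\<^sup>+ c. s (c(i := v)) \<partial>Pi\<^sub>M I M \<partial>M i)"
      using s by (intro product_nn_integral_insert_rev assms borel_measurable_simple_function)
    also have "\<dots> \<le> (\<integral>\<^sup>+ v. \<integral>\<^sup>+ c. f (c(i := v)) \<partial>Pi\<^sub>M I M \<partial>M i)"
      using le by (intro nn_integral_mono) (auto simp: le_fun_def)
    finally show ?thesis .
  qed
  then show ?thesis
    by (subst nn_integral_def) (auto intro!: SUP_least)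
qed

text \<open>The function \<open>r\<close> is only assumed separately measurable, and \<open>f\<close> and \<open>a\<close> are arbitrary: the induction
  integrates one coordinate at a time and absorbs its pair terms with the others into \<open>a\<close>.\<close>
lemma (in prob_space) nn_integral_PiM_pairwise_le:
  fixes a :: "'a \<Rightarrow> ennreal" and r :: "'a \<Rightarrow> 'a \<Rightarrow> ennreal" and K H :: ennreal
    and I :: "'i set"
  assumes fin: "finite I"
    and r_meas: "\<And>v. v \<in> space M \<Longrightarrow> (\<lambda>u. r u v) \<in> borel_measurable M"
    and r_sym: "\<And>u v. r u v = r v u"
    and r_le: "\<And>v. v \<in> space M \<Longrightarrow> (\<integral>\<^sup>+ u. r u v \<partial>M) \<le> H"
    and f_le: "\<And>c. c \<in> space (Pi\<^sub>M I (\<lambda>_. M)) \<Longrightarrow>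
      f c \<le> K + (\<Sum>m\<in>I. a (c m) + (\<Sum>j\<in>I - {m}. r (c m) (c j)))"
  shows "(\<integral>\<^sup>+ c. f c \<partial>Pi\<^sub>M I (\<lambda>_. M))
    \<le> K + of_nat (card I) * (\<integral>\<^sup>+ u. a u \<partial>M) + of_nat (card I * (card I - 1)) * H"
  using fin f_le
proof (induction I arbitrary: f a K rule: finite_induct)
  case empty
  interpret P: product_prob_space "\<lambda>_. M" "{} :: 'i set" by standard
  have "(\<integral>\<^sup>+ c. f c \<partial>Pi\<^sub>M ({} :: 'i set) (\<lambda>_. M)) \<le> (\<integral>\<^sup>+ c. K \<partial>Pi\<^sub>M ({} :: 'i set) (\<lambda>_. M))"
    by (rule nn_integral_mono) (use empty.prems in simp)
  also have "\<dots> = K" by (simp add: P.emeasure_space_1)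
  finally show ?case by simp
next
  case (insert i I)
  interpret P: product_sigma_finite "\<lambda>_. M" by standard
  let ?n = "card I" and ?a = "\<integral>\<^sup>+ u. a u \<partial>M"
  \<comment> \<open>The bound left by the induction hypothesis. The new coordinate \<open>v\<close>
    pairs with each remaining one in both orders, which replaces \<open>a\<close> by
    \<open>?b\<close> below and raises its integral by at most \<open>2 * H\<close>.\<close>
  let ?C = "K + of_nat ?n * (?a + 2 * H) + of_nat (?n * (?n - 1)) * H"
  have inner: "(\<integral>\<^sup>+ c. f (c(i := v)) \<partial>Pi\<^sub>M I (\<lambda>_. M)) \<le> a v + ?C" if v: "v \<in> space M" for v
  proof -
    let ?b = "\<lambda>u. a u + (r u v + r u v)"
    have "(\<integral>\<^sup>+ c. f (c(i := v)) \<partial>Pi\<^sub>M I (\<lambda>_. M))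
      \<le> (K + a v) + of_nat ?n * (\<integral>\<^sup>+ u. ?b u \<partial>M) + of_nat (?n * (?n - 1)) * H"
    proof (rule insert.IH)
      fix c assume c: "c \<in> space (Pi\<^sub>M I (\<lambda>_. M))"
      let ?c = "c(i := v)"
      have c': "?c \<in> space (Pi\<^sub>M (insert i I) (\<lambda>_. M))"
        using c v by (auto simp: space_PiM PiE_def extensional_def)
      have eq: "?c m = c m" if "m \<in> I" for m using that insert.hyps by auto
      have 1: "(\<Sum>j\<in>insert i I - {m}. r (c m) (?c j)) = r (c m) v + (\<Sum>j\<in>I - {m}. r (c m) (c j))"
        if m: "m \<in> I" for m
      proof -
        have "insert i I - {m} = insert i (I - {m})" using m insert.hyps by auto
        then show ?thesis using m insert.hyps eq by (auto intro!: sum.cong)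
      qed
      \<comment> \<open>Symmetry turns the pairs that start at \<open>v\<close> into sections in the
        first argument, where \<open>r_meas\<close> and \<open>r_le\<close> apply.\<close>
      have 2: "(\<Sum>j\<in>insert i I - {i}. r v (?c j)) = (\<Sum>m\<in>I. r (c m) v)"
        using insert.hyps by (auto intro!: sum.cong simp: r_sym)
      have 3: "(\<Sum>m\<in>I. a (?c m) + (\<Sum>j\<in>insert i I - {m}. r (?c m) (?c j)))
        = (\<Sum>m\<in>I. a (c m) + (r (c m) v + (\<Sum>j\<in>I - {m}. r (c m) (c j))))"
        by (intro sum.cong refl) (simp only: eq 1)
      have "f ?c \<le> K + (\<Sum>m\<in>insert i I. a (?c m) + (\<Sum>j\<in>insert i I - {m}. r (?c m) (?c j)))"
        using insert.prems[OF c'] .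
      also have "(\<Sum>m\<in>insert i I. a (?c m) + (\<Sum>j\<in>insert i I - {m}. r (?c m) (?c j)))
        = (a v + (\<Sum>m\<in>I. r (c m) v)) + (\<Sum>m\<in>I. a (c m) + (r (c m) v + (\<Sum>j\<in>I - {m}. r (c m) (c j))))"
        using insert.hyps by (simp only: sum.insert 2 3 fun_upd_same not_False_eq_True)
      also have "K + \<dots> = K + a v + (\<Sum>m\<in>I. ?b (c m) + (\<Sum>j\<in>I - {m}. r (c m) (c j)))"
        by (simp add: sum.distrib add_ac)
      finally show "f ?c \<le> \<dots>" .
    qed
    \<comment> \<open>Since \<open>a\<close> is arbitrary, the sections of \<open>r\<close> serve as
      the measurable summand.\<close>
    also have "(\<integral>\<^sup>+ u. ?b u \<partial>M) \<le> ?a + (\<integral>\<^sup>+ u. r u v + r u v \<partial>M)"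
      using r_meas[OF v] by (intro nn_integral_add_le) auto
    also have "(\<integral>\<^sup>+ u. r u v + r u v \<partial>M) \<le> 2 * H"
      using r_meas[OF v] add_mono[OF r_le[OF v] r_le[OF v]] by (simp add: nn_integral_add mult_2)
    finally show ?thesis
      by (simp add: add_ac add_left_mono add_right_mono mult_left_mono)
  qed
  have "(\<integral>\<^sup>+ c. f c \<partial>Pi\<^sub>M (insert i I) (\<lambda>_. M))
      \<le> (\<integral>\<^sup>+ v. \<integral>\<^sup>+ c. f (c(i := v)) \<partial>Pi\<^sub>M I (\<lambda>_. M) \<partial>M)"
    using insert.hyps by (rule P.nn_integral_PiM_insert_le)
  also have "\<dots> \<le> (\<integral>\<^sup>+ v. a v + ?C \<partial>M)"
    by (rule nn_integral_mono) (rule inner)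
  also have "\<dots> \<le> ?a + ?C"
    using nn_integral_add_le[of "\<lambda>_. ?C" M a] by (simp add: emeasure_space_1)
  also have "\<dots> = K + of_nat (Suc ?n) * ?a + of_nat (2 * ?n + ?n * (?n - 1)) * H"
    unfolding of_nat_add of_nat_Suc of_nat_mult[of 2] by (simp add: algebra_simps del: of_nat_mult)
  \<comment> \<open>The count of ordered pairs: \<open>2 * ?n\<close> new ones and the old ones. The
    case split deals with truncated subtraction at 0.\<close>
  also have "2 * ?n + ?n * (?n - 1) = Suc ?n * ?n"
    by (cases ?n) auto
  finally show ?case using insert.hyps by simp
qed

section \<open>Pointwise bound on the logarithm of a mixture\<close>

text \<open>The sum \<open>p + S\<close> is at most twice its larger summand, whence the 2 in
  \<open>m / 2\<close> and in the slope of the linear term. The free parameter \<open>L\<close>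
  lowers that slope at an additive cost of \<open>L\<close>.\<close>

lemma ln_mixture_le:
  fixes p S m t L :: real
  assumes "p > 0" "S \<ge> 0" "m > 0" "t \<ge> 0" "L \<ge> 0"
  shows "max 0 (ln ((p + S) / m)) \<le> t + max 0 (ln p - t - ln (m / 2)) + L + 2 * exp (- t) / (m * exp L) * S"
proof -
  let ?k = "2 * exp (- t) / (m * exp L) * S"
  have k: "?k \<ge> 0" using assms by simp
  have pos: "(p + S) / m > 0" using assms by simp
  have "ln ((p + S) / m) \<le> t + max 0 (ln p - t - ln (m / 2)) + L + ?k"
  proof (cases "S \<le> p")
    case True
    then have "ln ((p + S) / m) \<le> ln (p / (m / 2))"
      using assms pos by (subst ln_le_cancel_iff) (auto simp: field_simps)
    also have "\<dots> = ln p - ln (m / 2)" using assms by (simp add: ln_div ln_mult_pos)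
    finally show ?thesis using k assms by linarith
  next
    case False
    then have S: "S > 0" using assms by simp
    then have kpos: "?k > 0" using assms by simp
    \<comment> \<open>The product \<open>?k * exp (t + L)\<close> equals
      \<open>2 * S / m\<close>.\<close>
    have "ln ((p + S) / m) \<le> ln (?k * exp (t + L))"
      using assms pos S False
      by (subst ln_le_cancel_iff) (auto simp: field_simps exp_add exp_minus)
    also have "\<dots> = ln ?k + (t + L)" using ln_mult_pos[OF kpos exp_gt_zero] by simp
    also have "ln ?k \<le> ?k - 1" using kpos by (rule ln_le_minus_one)
    finally show ?thesis by linarith
  qed
  then show ?thesis using k assms by auto
qed

section \<open>Conditional densities over a general reference measure\<close>

locale conditional_density = prob_space QU
  for QU :: "'u measure" and piX :: "'x measure" and q :: "'u \<Rightarrow> 'x \<Rightarrow> real" +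
  assumes q_meas: "(\<lambda>(u, x). q u x) \<in> borel_measurable (QU \<Otimes>\<^sub>M piX)"
    and q_nonneg: "\<And>u x. u \<in> space QU \<Longrightarrow> x \<in> space piX \<Longrightarrow> 0 \<le> q u x"
    and q_prob: "\<And>u. u \<in> space QU \<Longrightarrow> (\<integral>\<^sup>+ x. ennreal (q u x) \<partial>piX) = 1"
begin

text \<open>Kept in \<open>ennreal\<close> because the output density may be infinite at some
  points; the real-valued \<open>out_dens\<close> sends infinity to 0.\<close>

definition out :: "'x \<Rightarrow> ennreal" where
  "out x = (\<integral>\<^sup>+ u. ennreal (q u x) \<partial>QU)"

lemma q_section [measurable]: "u \<in> space QU \<Longrightarrow> q u \<in> borel_measurable piX"
  using measurable_compose[OF measurable_Pair1' q_meas] by simp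

lemma q_section2 [measurable]: "x \<in> space piX \<Longrightarrow> (\<lambda>u. q u x) \<in> borel_measurable QU"
  using measurable_compose[OF measurable_Pair2' q_meas] by simp

lemma out_measurable [measurable]: "out \<in> borel_measurable piX"
proof -
  have "case_prod (\<lambda>x u. q u x) \<in> borel_measurable (piX \<Otimes>\<^sub>M QU)"
    using measurable_compose[OF measurable_pair_swap' q_meas] by (simp add: case_prod_beta)
  then have "case_prod (\<lambda>x u. ennreal (q u x)) \<in> borel_measurable (piX \<Otimes>\<^sub>M QU)"
    by (simp add: case_prod_beta)
  then show ?thesis
    unfolding out_def by (rule borel_measurable_nn_integral)
qed

text \<open>Tonelli for a sigma-finite \<open>N\<close> that stands in for \<open>piX\<close> on the
  same sigma-algebra. It serves for restrictions of \<open>piX\<close> and for the output law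
  \<open>cond_out piX q v\<close> of a codeword.\<close>

lemma sections_sigma_finite:
  assumes sf: "sigma_finite_measure N" and sets [measurable_cong]: "sets N = sets piX"
    and g: "g \<in> borel_measurable piX"
  shows "(\<lambda>u. \<integral>\<^sup>+ x. ennreal (q u x) * g x \<partial>N) \<in> borel_measurable QU"
    and "(\<integral>\<^sup>+ u. \<integral>\<^sup>+ x. ennreal (q u x) * g x \<partial>N \<partial>QU) = (\<integral>\<^sup>+ x. out x * g x \<partial>N)"
proof -
  interpret N: sigma_finite_measure N by fact
  interpret pair_sigma_finite QU N ..
  have g' [measurable]: "g \<in> borel_measurable N"
    using g by (simp cong: measurable_cong_sets)
  have "sets (QU \<Otimes>\<^sub>M piX) = sets (QU \<Otimes>\<^sub>M N)"
    by (intro sets_pair_measure_cong) (simp_all add: sets)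
  then have q' [measurable]: "(\<lambda>(u, x). q u x) \<in> borel_measurable (QU \<Otimes>\<^sub>M N)"
    using q_meas by (simp cong: measurable_cong_sets)
  have meas: "(\<lambda>(u, x). ennreal (q u x) * g x) \<in> borel_measurable (QU \<Otimes>\<^sub>M N)"
    by measurable
  show "(\<lambda>u. \<integral>\<^sup>+ x. ennreal (q u x) * g x \<partial>N) \<in> borel_measurable QU"
    using N.borel_measurable_nn_integral[OF meas] .
  have "(\<integral>\<^sup>+ u. \<integral>\<^sup>+ x. ennreal (q u x) * g x \<partial>N \<partial>QU) = (\<integral>\<^sup>+ x. \<integral>\<^sup>+ u. ennreal (q u x) * g x \<partial>QU \<partial>N)"
    using Fubini'[OF meas] by simp
  also have "\<dots> = (\<integral>\<^sup>+ x. out x * g x \<partial>N)"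
    unfolding out_def using sets_eq_imp_space_eq[OF sets]
    by (intro nn_integral_cong nn_integral_multc) auto
  finally show "(\<integral>\<^sup>+ u. \<integral>\<^sup>+ x. ennreal (q u x) * g x \<partial>N \<partial>QU) = (\<integral>\<^sup>+ x. out x * g x \<partial>N)" .
qed

text \<open>On a set of finite measure the two integrals may be swapped, and each conditional
  density has mass at most 1 there.\<close>

lemma out_mass_le_1:
  assumes T: "T \<in> sets piX" "emeasure piX T < \<infinity>"
  shows "(\<integral>\<^sup>+ x. out x * indicator T x \<partial>piX) \<le> 1"
proof -
  \<comment> \<open>Restricting by a density keeps the sigma-algebra of \<open>piX\<close>, as
    \<open>sections_sigma_finite\<close> demands.\<close>
  let ?N = "density piX (indicator T)"
  have "finite_measure ?N"
    using T sets.sets_into_space[OF T(1)]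
    by (intro finite_measureI) (auto simp: emeasure_density Int_absorb1)
  then interpret N: finite_measure ?N .
  have "(\<integral>\<^sup>+ x. out x * indicator T x \<partial>piX) = (\<integral>\<^sup>+ x. out x * 1 \<partial>?N)"
    using T by (subst nn_integral_density) (auto simp: mult.commute)
  also have "\<dots> = (\<integral>\<^sup>+ u. \<integral>\<^sup>+ x. ennreal (q u x) * 1 \<partial>?N \<partial>QU)"
    by (rule sections_sigma_finite(2)[symmetric]) (auto intro: N.sigma_finite_measure_axioms)
  also have "\<dots> \<le> (\<integral>\<^sup>+ u. 1 \<partial>QU)"
  proof (intro nn_integral_mono)
    fix u assume u: "u \<in> space QU"
    have "(\<integral>\<^sup>+ x. ennreal (q u x) * 1 \<partial>?N) = (\<integral>\<^sup>+ x. indicator T x * ennreal (q u x) \<partial>piX)"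
      using T u by (simp add: nn_integral_density)
    also have "\<dots> \<le> (\<integral>\<^sup>+ x. ennreal (q u x) \<partial>piX)"
      by (intro nn_integral_mono) (auto split: split_indicator)
    finally show "(\<integral>\<^sup>+ x. ennreal (q u x) * 1 \<partial>?N) \<le> 1" using q_prob[OF u] by simp
  qed
  also have "\<dots> = 1" by (simp add: emeasure_space_1)
  finally show ?thesis .
qed

text \<open>The set where \<open>q v\<close> is positive is a countable union of superlevel sets,
  each of finite measure by Markov's inequality because \<open>q v\<close> integrates to 1.\<close>

lemma AE_on_support:
  assumes v: "v \<in> space QU"
    and fin: "\<And>T. T \<in> sets piX \<Longrightarrow> emeasure piX T < \<infinity> \<Longrightarrow> AE x in piX. x \<in> T \<longrightarrow> P x"
  shows "AE x in piX. 0 < q v x \<longrightarrow> P x"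
proof -
  \<comment> \<open>The condition \<open>q v x \<ge> 1 / Suc k\<close>, written in the form that
    Markov's inequality takes.\<close>
  define T where "T k = {x \<in> space piX. 1 \<le> ennreal (real (Suc k)) * ennreal (q v x)}" for k
  have [measurable]: "q v \<in> borel_measurable piX" using v by simp
  have [measurable]: "T k \<in> sets piX" for k unfolding T_def by measurable
  have "emeasure piX (T k) < \<infinity>" for k
  proof -
    have "emeasure piX (T k) \<le> ennreal (real (Suc k)) * (\<integral>\<^sup>+ x. ennreal (q v x) * indicator (space piX) x \<partial>piX)"
      unfolding T_def by (intro nn_integral_Markov_inequality) auto
    also have "(\<integral>\<^sup>+ x. ennreal (q v x) * indicator (space piX) x \<partial>piX) = (\<integral>\<^sup>+ x. ennreal (q v x) \<partial>piX)"
      by (intro nn_integral_cong) auto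
    finally show ?thesis
      using q_prob[OF v] by (auto intro: order.strict_trans1)
  qed
  then have "AE x in piX. \<forall>k. x \<in> T k \<longrightarrow> P x"
    unfolding AE_all_countable by (intro allI fin) auto
  with AE_space show ?thesis
  proof eventually_elim
    case (elim x)
    show ?case
    proof
      assume pos: "0 < q v x"
      then obtain k where "1 / real (Suc k) < q v x" using nat_approx_posE by blast
      then have "1 \<le> real (Suc k) * q v x" by (simp add: field_simps)
      then have "x \<in> T k"
        using elim pos by (simp add: T_def ennreal_mult[symmetric] del: of_nat_Suc)
      then show "P x" using elim by blast
    qed
  qed
qed

text \<open>A finite integral over each set of finite measure forces finiteness almost everywhere
  there. Hence \<open>out_dens\<close> represents \<open>out\<close> wherever a codeword has mass,
  up to a null set.\<close>

lemma out_finite_on_support: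
  assumes v: "v \<in> space QU"
  shows "AE x in piX. 0 < q v x \<longrightarrow> out x < \<infinity>"
proof (rule AE_on_support[OF v])
  fix T assume T [measurable]: "T \<in> sets piX" and fin: "emeasure piX T < \<infinity>"
  have "(\<integral>\<^sup>+ x. out x * indicator T x \<partial>piX) \<noteq> \<infinity>"
    using out_mass_le_1[OF T fin] by (auto simp: top_unique)
  then have "AE x in piX. out x * indicator T x \<noteq> \<infinity>"
    by (intro nn_integral_PInf_AE) auto
  then show "AE x in piX. x \<in> T \<longrightarrow> out x < \<infinity>"
    by eventually_elim (auto simp: less_top)
qed

text \<open>By exhaustion: \<open>F\<close> is a countable union of sets of finite measure whose output masses approach the
  supremum, so a set of finite measure outside \<open>F\<close> carries no output mass.\<close>
lemma ex_output_support:
  "\<exists>F\<in>sets piX. sigma_finite_measure (density piX (indicator F)) \<and>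
    (\<forall>v\<in>space QU. AE x in piX. 0 < q v x \<longrightarrow> x \<notin> F \<longrightarrow> out x = 0)"
proof -
  define \<F> where "\<F> = {T \<in> sets piX. emeasure piX T < \<infinity>}"
  define I where "I T = (\<integral>\<^sup>+ x. out x * indicator T x \<partial>piX)" for T
  have "\<F> \<noteq> {}" by (auto simp: \<F>_def intro!: exI[of _ "{}"])
  \<comment> \<open>The supremum of the output masses is already the supremum along a sequence
    \<open>A n\<close> of sets of finite measure.\<close>
  then obtain t where "range t \<subseteq> I ` \<F>" and t: "(SUP T\<in>\<F>. I T) = (SUP n::nat. t n)"
    using ennreal_SUP_countable_SUP[of \<F> I] by auto
  then have "\<forall>n. \<exists>T\<in>\<F>. t n = I T" by auto
  then obtain A where A: "\<And>n. A n \<in> \<F>" "\<And>n. t n = I (A n)" by metis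
  define F where "F = (\<Union>n. A n)"
  have [measurable]: "A n \<in> sets piX" for n using A by (auto simp: \<F>_def)
  have F [measurable]: "F \<in> sets piX" unfolding F_def by measurable
  have sup_le: "(SUP T\<in>\<F>. I T) \<le> 1"
    using out_mass_le_1 by (auto intro!: SUP_least simp: I_def \<F>_def)
  have null: "AE x in piX. x \<in> T \<longrightarrow> x \<notin> F \<longrightarrow> out x = 0" if T: "T \<in> \<F>" for T
  proof -
    have [measurable]: "T \<in> sets piX" using T by (auto simp: \<F>_def)
    \<comment> \<open>The sets \<open>T - F\<close> and \<open>A n\<close> are disjoint and their
      union has finite measure, so the union competes in the supremum.\<close>
    have "I (T - F) + I (A n) \<le> (SUP T\<in>\<F>. I T)" for n
    proof -
      have "I (T - F) + I (A n) = (\<integral>\<^sup>+ x. out x * indicator (T - F) x + out x * indicator (A n) x \<partial>piX)"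
        unfolding I_def by (intro nn_integral_add[symmetric]) auto
      also have "\<dots> = I ((T - F) \<union> A n)"
        unfolding I_def by (intro nn_integral_cong) (auto simp: F_def split: split_indicator)
      also have "\<dots> \<le> (SUP T\<in>\<F>. I T)"
      proof (rule SUP_upper)
        have "emeasure piX ((T - F) \<union> A n) \<le> emeasure piX T + emeasure piX (A n)"
          by (rule order.trans[OF emeasure_subadditive]) (auto intro!: add_right_mono emeasure_mono)
        also have "\<dots> < \<infinity>" using T A(1)[of n] by (auto simp: \<F>_def)
        finally show "(T - F) \<union> A n \<in> \<F>" by (auto simp: \<F>_def)
      qed
      finally show ?thesis .
    qed
    then have "I (T - F) + (SUP n. t n) \<le> (SUP T\<in>\<F>. I T)"
      by (subst ennreal_SUP_add_right) (auto intro!: SUP_least simp: A)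
    then have "(SUP T\<in>\<F>. I T) + I (T - F) \<le> (SUP T\<in>\<F>. I T) + 0" by (simp add: t add.commute)
    \<comment> \<open>Finiteness allows the supremum to be cancelled, which leaves no mass for
      \<open>T - F\<close>.\<close>
    moreover have "(SUP T\<in>\<F>. I T) < top" using sup_le by (auto intro: order.strict_trans1)
    ultimately have "I (T - F) = 0"
      unfolding ennreal_add_left_cancel_le by (metis infinity_ennreal_def less_irrefl le_zero_eq)
    then have "AE x in piX. out x * indicator (T - F) x = 0"
      unfolding I_def by (subst (asm) nn_integral_0_iff_AE) auto
    then show ?thesis by eventually_elim auto
  qed
  show ?thesis
  proof (intro bexI conjI ballI)
    show "F \<in> sets piX" by fact
    let ?N = "density piX (indicator F)"
    \<comment> \<open>The complement of \<open>F\<close> is null for \<open>?N\<close>, and the sets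
      \<open>A n\<close> cover \<open>F\<close> with finite measure each.\<close>
    let ?C = "insert (space piX - F) (range A)"
    show "sigma_finite_measure ?N"
    proof (intro sigma_finite_measure.intro exI[of _ ?C] conjI ballI)
      show "countable ?C" by simp
      show "?C \<subseteq> sets ?N" by auto
      show "\<Union> ?C = space ?N"
        using sets.sets_into_space[OF F] by (auto simp: F_def)
      fix a assume "a \<in> ?C"
      then consider "a = space piX - F" | n where "a = A n" by auto
      then show "emeasure ?N a \<noteq> \<infinity>"
      proof cases
        case 1
        then show ?thesis by (simp add: emeasure_restricted)
      next
        case 2
        have "F \<inter> A n = A n" by (auto simp: F_def)
        with 2 A(1)[of n] show ?thesis by (simp add: emeasure_restricted \<F>_def)
      qed
    qed
    fix v assume "v \<in> space QU"
    then show "AE x in piX. 0 < q v x \<longrightarrow> x \<notin> F \<longrightarrow> out x = 0"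
      by (rule AE_on_support) (auto intro!: null simp: \<F>_def)
  qed
qed

text \<open>If \<open>g\<close> vanishes with \<open>out\<close>, the part of \<open>piX\<close>
  outside the set \<open>F\<close> of \<open>ex_output_support\<close> contributes nothing, and on
  \<open>F\<close> the measure is sigma-finite.\<close>

lemma borel_measurable_nn_integral_out:
  assumes [measurable]: "g \<in> borel_measurable piX" and g: "\<And>x. out x = 0 \<Longrightarrow> g x = 0"
  shows "(\<lambda>u. \<integral>\<^sup>+ x. ennreal (q u x) * g x \<partial>piX) \<in> borel_measurable QU"
proof -
  obtain F where F [measurable]: "F \<in> sets piX"
    and sf: "sigma_finite_measure (density piX (indicator F))"
    and null: "\<And>v. v \<in> space QU \<Longrightarrow> AE x in piX. 0 < q v x \<longrightarrow> x \<notin> F \<longrightarrow> out x = 0"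
    using ex_output_support by blast
  have "(\<integral>\<^sup>+ x. ennreal (q u x) * g x \<partial>piX)
      = (\<integral>\<^sup>+ x. ennreal (q u x) * g x \<partial>density piX (indicator F))" if u: "u \<in> space QU" for u
  proof -
    have "(\<integral>\<^sup>+ x. ennreal (q u x) * g x \<partial>piX) = (\<integral>\<^sup>+ x. indicator F x * (ennreal (q u x) * g x) \<partial>piX)"
    proof (rule nn_integral_cong_AE)
      show "AE x in piX. ennreal (q u x) * g x = indicator F x * (ennreal (q u x) * g x)"
        using null[OF u]
      proof eventually_elim
        case (elim x)
        then show ?case
          \<comment> \<open>If \<open>q u x\<close> is not positive, \<open>ennreal\<close> maps it
            to 0 and both sides vanish; if it is positive, \<open>g x = 0\<close> off
            \<open>F\<close>.\<close>
          by (cases "0 < q u x") (auto simp: g ennreal_neg split: split_indicator)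
      qed
    qed
    then show ?thesis using u by (simp add: nn_integral_density)
  qed
  then show ?thesis
    using sections_sigma_finite(1)[OF sf _ assms(1)] by (simp cong: measurable_cong)
qed

section \<open>Relative entropy for a fixed codebook\<close>

lemma nn_integral_cond_out:
  assumes "u \<in> space QU" "g \<in> borel_measurable piX"
  shows "(\<integral>\<^sup>+ x. g x \<partial>cond_out piX q u) = (\<integral>\<^sup>+ x. ennreal (q u x) * g x \<partial>piX)"
  unfolding cond_out_def using assms by (intro nn_integral_density) auto

lemma emeasure_cond_out:
  assumes "u \<in> space QU"
  shows "emeasure (cond_out piX q u) (space piX) = 1"
  using nn_integral_cond_out[of u "\<lambda>_. 1"] assms q_prob[of u] by (simp add: cond_out_def)

text \<open>The mixture splits into codewords of weight \<open>1 / m\<close>, and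
  \<open>ln_mixture_le\<close> is applied to each with \<open>S\<close> the sum of the others.
  Integration then yields the shape of single terms plus pair terms that
  \<open>nn_integral_PiM_pairwise_le\<close> expects; \<open>L\<close> is still free.\<close>

lemma rel_ent_mixture_le:
  fixes m :: nat and t :: real and L :: "'x \<Rightarrow> real"
  assumes m: "m \<ge> 1" and t: "t \<ge> 0"
    and L [measurable]: "L \<in> borel_measurable piX" and L_nonneg: "\<And>x. L x \<ge> 0"
    and c: "c \<in> space (Pi\<^sub>M {..<m} (\<lambda>_. QU))"
  defines "\<kappa> \<equiv> \<lambda>x. 2 * exp (- t) / (real m * exp (L x))"
  shows "rel_ent_pos piX (mix_dens q m c) \<le>
    (\<Sum>i<m. ennreal (1 / real m) *
        ((\<integral>\<^sup>+ x. ennreal (max 0 (ln (q (c i) x) - t - ln (real m / 2))) \<partial>cond_out piX q (c i))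
          + (ennreal t + (\<integral>\<^sup>+ x. ennreal (q (c i) x) * ennreal (L x) \<partial>piX)))
      + (\<Sum>j\<in>{..<m} - {i}. ennreal (1 / real m) *
          (\<integral>\<^sup>+ x. ennreal (q (c i) x) * (ennreal (\<kappa> x) * ennreal (q (c j) x)) \<partial>piX)))"
proof -
  define w where "w = 1 / real m"
  have w: "w \<ge> 0" by (simp add: w_def)
  have cs: "c i \<in> space QU" if "i < m" for i
    using c that by (auto simp: space_PiM)
  have [measurable]: "q (c i) \<in> borel_measurable piX" if "i < m" for i
    using cs[OF that] by simp
  have [measurable]: "\<kappa> \<in> borel_measurable piX" unfolding \<kappa>_def by measurable
  have \<kappa>: "\<kappa> x \<ge> 0" for x unfolding \<kappa>_def by simp
  define h where "h i x = max 0 (ln (q (c i) x) - t - ln (real m / 2))" for i x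
  have h_nonneg: "h i x \<ge> 0" for i x by (simp add: h_def)
  have [measurable]: "h i \<in> borel_measurable piX" if "i < m" for i
    unfolding h_def using that by measurable
  have mix_meas [measurable]: "mix_dens q m c \<in> borel_measurable piX"
    unfolding mix_dens_def by measurable
  have pointwise: "ennreal (mix_dens q m c x) * ennreal (max 0 (ln (mix_dens q m c x)))
    \<le> (\<Sum>i<m. ennreal w * (ennreal (q (c i) x) * ennreal (h i x)
          + (ennreal (q (c i) x) * ennreal t + ennreal (q (c i) x) * ennreal (L x)))
        + (\<Sum>j\<in>{..<m} - {i}. ennreal w * (ennreal (q (c i) x) * (ennreal (\<kappa> x) * ennreal (q (c j) x)))))"
    if x: "x \<in> space piX" for x
  proof -
    let ?l = "max 0 (ln (mix_dens q m c x))"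
    have qn: "q (c i) x \<ge> 0" if "i < m" for i
      using q_nonneg[OF cs[OF that] x] .
    have mix_nonneg: "mix_dens q m c x \<ge> 0"
      unfolding mix_dens_def by (intro divide_nonneg_nonneg sum_nonneg) (auto intro: qn)
    have summand: "q (c i) x * ?l \<le> q (c i) x * (h i x + t + L x + \<kappa> x * (\<Sum>j\<in>{..<m} - {i}. q (c j) x))"
      if i: "i < m" for i
    \<comment> \<open>\<open>ln_mixture_le\<close> requires \<open>p > 0\<close>; a codeword with
      zero density at \<open>x\<close> contributes nothing to either side.\<close>
    proof (cases "q (c i) x = 0")
      case False
      then have "q (c i) x > 0" using qn[OF i] by simp
      moreover have "mix_dens q m c x = (q (c i) x + (\<Sum>j\<in>{..<m} - {i}. q (c j) x)) / real m"
        unfolding mix_dens_def using i by (subst sum.remove[of _ i]) auto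
      moreover have "(\<Sum>j\<in>{..<m} - {i}. q (c j) x) \<ge> 0"
        using qn by (intro sum_nonneg) auto
      ultimately have "?l \<le> t + h i x + L x + \<kappa> x * (\<Sum>j\<in>{..<m} - {i}. q (c j) x)"
        using ln_mixture_le[of "q (c i) x" "\<Sum>j\<in>{..<m} - {i}. q (c j) x" "real m" t "L x"] m t L_nonneg[of x]
        by (simp only: h_def \<kappa>_def)
      then show ?thesis using qn[OF i] by (intro mult_left_mono) auto
    qed simp
    have "mix_dens q m c x * ?l = (\<Sum>i<m. w * (q (c i) x * ?l))"
      by (simp add: w_def mix_dens_def sum_distrib_left sum_distrib_right sum_divide_distrib)
    also have "\<dots> \<le> (\<Sum>i<m. w *
        (q (c i) x * (h i x + t + L x + \<kappa> x * (\<Sum>j\<in>{..<m} - {i}. q (c j) x))))"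
      by (rule sum_mono, rule mult_left_mono) (auto intro: summand w)
    also have "\<dots> = (\<Sum>i<m. w * (q (c i) x * h i x + (q (c i) x * t + q (c i) x * L x))
        + (\<Sum>j\<in>{..<m} - {i}. w * (q (c i) x * (\<kappa> x * q (c j) x))))"
      by (intro sum.cong refl) (simp only: sum_distrib_left[symmetric] distrib_left add.assoc)
    \<comment> \<open>The real inequality is moved to \<open>ennreal\<close> only here;
      nonnegativity of all terms lets \<open>ennreal\<close> distribute over sums and
      products.\<close>
    finally have "ennreal (mix_dens q m c x * ?l) \<le> ennreal \<dots>" by (rule ennreal_leI)
    also have "\<dots> = (\<Sum>i<m. ennreal (w * (q (c i) x * h i x + (q (c i) x * t + q (c i) x * L x))
        + (\<Sum>j\<in>{..<m} - {i}. w * (q (c i) x * (\<kappa> x * q (c j) x)))))"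
      using t by (intro sum_ennreal[symmetric]) (intro add_nonneg_nonneg sum_nonneg mult_nonneg_nonneg w h_nonneg L_nonneg \<kappa> qn; simp)
    also have "\<dots> = (\<Sum>i<m. ennreal w * (ennreal (q (c i) x) * ennreal (h i x)
          + (ennreal (q (c i) x) * ennreal t + ennreal (q (c i) x) * ennreal (L x)))
        + (\<Sum>j\<in>{..<m} - {i}. ennreal w * (ennreal (q (c i) x) * (ennreal (\<kappa> x) * ennreal (q (c j) x)))))"
    proof (intro sum.cong refl)
      fix i assume "i \<in> {..<m}"
      then have i: "i < m" by simp
      have "(\<Sum>j\<in>{..<m} - {i}. ennreal w * (ennreal (q (c i) x) * (ennreal (\<kappa> x) * ennreal (q (c j) x))))
        = (\<Sum>j\<in>{..<m} - {i}. ennreal (w * (q (c i) x * (\<kappa> x * q (c j) x))))"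
        using i by (intro sum.cong refl) (simp add: ennreal_mult w qn \<kappa>)
      also have "\<dots> = ennreal (\<Sum>j\<in>{..<m} - {i}. w * (q (c i) x * (\<kappa> x * q (c j) x)))"
        using i by (intro sum_ennreal) (simp add: w qn \<kappa>)
      finally have cross: "(\<Sum>j\<in>{..<m} - {i}. ennreal w * (ennreal (q (c i) x) * (ennreal (\<kappa> x) * ennreal (q (c j) x))))
        = \<dots>" .
      have cross_nonneg: "(\<Sum>j\<in>{..<m} - {i}. w * (q (c i) x * (\<kappa> x * q (c j) x))) \<ge> 0"
        using i by (intro sum_nonneg) (simp add: w qn \<kappa>)
      have self: "ennreal (w * (q (c i) x * h i x + (q (c i) x * t + q (c i) x * L x)))
        = ennreal w * (ennreal (q (c i) x) * ennreal (h i x)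
          + (ennreal (q (c i) x) * ennreal t + ennreal (q (c i) x) * ennreal (L x)))"
        using i t by (simp add: ennreal_plus ennreal_mult w qn h_nonneg L_nonneg)
      show "ennreal (w * (q (c i) x * h i x + (q (c i) x * t + q (c i) x * L x))
        + (\<Sum>j\<in>{..<m} - {i}. w * (q (c i) x * (\<kappa> x * q (c j) x))))
        = ennreal w * (ennreal (q (c i) x) * ennreal (h i x)
          + (ennreal (q (c i) x) * ennreal t + ennreal (q (c i) x) * ennreal (L x)))
        + (\<Sum>j\<in>{..<m} - {i}. ennreal w * (ennreal (q (c i) x) * (ennreal (\<kappa> x) * ennreal (q (c j) x))))"
        unfolding cross self[symmetric] using i t
        by (intro ennreal_plus cross_nonneg) (simp add: w qn h_nonneg L_nonneg)
    qed
    finally show ?thesis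
      by (simp only: ennreal_mult[OF mix_nonneg max.cobounded1])
  qed
  have "rel_ent_pos piX (mix_dens q m c)
    = (\<integral>\<^sup>+ x. ennreal (mix_dens q m c x) * ennreal (max 0 (ln (mix_dens q m c x))) \<partial>piX)"
    unfolding rel_ent_pos_def by (intro nn_integral_density) auto
  also have "\<dots> \<le> (\<integral>\<^sup>+ x. (\<Sum>i<m. ennreal w * (ennreal (q (c i) x) * ennreal (h i x)
          + (ennreal (q (c i) x) * ennreal t + ennreal (q (c i) x) * ennreal (L x)))
        + (\<Sum>j\<in>{..<m} - {i}. ennreal w * (ennreal (q (c i) x) * (ennreal (\<kappa> x) * ennreal (q (c j) x))))) \<partial>piX)"
    by (intro nn_integral_mono pointwise)
  also have "\<dots> = (\<Sum>i<m. ennreal w * ((\<integral>\<^sup>+ x. ennreal (q (c i) x) * ennreal (h i x) \<partial>piX)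
          + ((\<integral>\<^sup>+ x. ennreal (q (c i) x) * ennreal t \<partial>piX) + (\<integral>\<^sup>+ x. ennreal (q (c i) x) * ennreal (L x) \<partial>piX)))
      + (\<Sum>j\<in>{..<m} - {i}. ennreal w *
          (\<integral>\<^sup>+ x. ennreal (q (c i) x) * (ennreal (\<kappa> x) * ennreal (q (c j) x)) \<partial>piX)))"
  proof (subst nn_integral_sum, goal_cases)
    case 2
    show ?case
    proof (intro sum.cong refl, subst nn_integral_add, goal_cases)
      case (3 i)
      then have [simp]: "i < m" by simp
      have "(\<integral>\<^sup>+ x. (\<Sum>j\<in>{..<m} - {i}. ennreal w * (ennreal (q (c i) x) * (ennreal (\<kappa> x) * ennreal (q (c j) x)))) \<partial>piX)
        = (\<Sum>j\<in>{..<m} - {i}. ennreal w * (\<integral>\<^sup>+ x. ennreal (q (c i) x) * (ennreal (\<kappa> x) * ennreal (q (c j) x)) \<partial>piX))"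
        by (subst nn_integral_sum) (auto intro!: sum.cong nn_integral_cmult)
      then show ?case by (simp add: nn_integral_add nn_integral_cmult)
    qed auto
  qed auto
  also have "\<dots> = (\<Sum>i<m. ennreal w *
        ((\<integral>\<^sup>+ x. ennreal (max 0 (ln (q (c i) x) - t - ln (real m / 2))) \<partial>cond_out piX q (c i))
          + (ennreal t + (\<integral>\<^sup>+ x. ennreal (q (c i) x) * ennreal (L x) \<partial>piX)))
      + (\<Sum>j\<in>{..<m} - {i}. ennreal w *
          (\<integral>\<^sup>+ x. ennreal (q (c i) x) * (ennreal (\<kappa> x) * ennreal (q (c j) x)) \<partial>piX)))"
  proof (intro sum.cong refl)
    fix i assume "i \<in> {..<m}"
    then have i: "c i \<in> space QU" "i < m" using cs by auto
    have "(\<integral>\<^sup>+ x. ennreal (q (c i) x) * ennreal t \<partial>piX) = ennreal t"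
      using i q_prob by (simp add: nn_integral_multc)
    moreover have "(\<integral>\<^sup>+ x. ennreal (q (c i) x) * ennreal (h i x) \<partial>piX)
      = (\<integral>\<^sup>+ x. ennreal (max 0 (ln (q (c i) x) - t - ln (real m / 2))) \<partial>cond_out piX q (c i))"
      unfolding h_def using i by (intro nn_integral_cond_out[symmetric]) auto
    ultimately show "ennreal w * ((\<integral>\<^sup>+ x. ennreal (q (c i) x) * ennreal (h i x) \<partial>piX)
          + ((\<integral>\<^sup>+ x. ennreal (q (c i) x) * ennreal t \<partial>piX) + (\<integral>\<^sup>+ x. ennreal (q (c i) x) * ennreal (L x) \<partial>piX)))
      + (\<Sum>j\<in>{..<m} - {i}. ennreal w *
          (\<integral>\<^sup>+ x. ennreal (q (c i) x) * (ennreal (\<kappa> x) * ennreal (q (c j) x)) \<partial>piX))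
      = ennreal w *
        ((\<integral>\<^sup>+ x. ennreal (max 0 (ln (q (c i) x) - t - ln (real m / 2))) \<partial>cond_out piX q (c i))
          + (ennreal t + (\<integral>\<^sup>+ x. ennreal (q (c i) x) * ennreal (L x) \<partial>piX)))
      + (\<Sum>j\<in>{..<m} - {i}. ennreal w *
          (\<integral>\<^sup>+ x. ennreal (q (c i) x) * (ennreal (\<kappa> x) * ennreal (q (c j) x)) \<partial>piX))" by (simp only:)
  qed
  finally show ?thesis unfolding w_def .
qed

section \<open>Expectation over the codebook\<close>

text \<open>Absorbing \<open>q v\<close> into the measure gives the probability measure
  \<open>cond_out piX q v\<close>, for which Tonelli is available. Averaging over \<open>u\<close>
  turns \<open>q u\<close> into \<open>out\<close>, and \<open>out\<close> is finite almost
  everywhere for that measure, so \<open>le\<close> applies uniformly in \<open>v\<close>.\<close>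

lemma nn_integral_collision_le:
  assumes v: "v \<in> space QU" and \<kappa> [measurable]: "\<kappa> \<in> borel_measurable piX"
    and le: "\<And>x. out x < \<infinity> \<Longrightarrow> out x * \<kappa> x \<le> C"
  shows "(\<lambda>u. \<integral>\<^sup>+ x. ennreal (q u x) * (\<kappa> x * ennreal (q v x)) \<partial>piX) \<in> borel_measurable QU"
    and "(\<integral>\<^sup>+ u. \<integral>\<^sup>+ x. ennreal (q u x) * (\<kappa> x * ennreal (q v x)) \<partial>piX \<partial>QU) \<le> C"
proof -
  let ?N = "cond_out piX q v"
  have space: "space ?N = space piX" by (simp add: cond_out_def)
  interpret N: finite_measure ?N
    using emeasure_cond_out[OF v] by (intro finite_measureI) (simp add: space)
  have sets: "sets ?N = sets piX" by (simp add: cond_out_def)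
  have eq: "(\<integral>\<^sup>+ x. ennreal (q u x) * (\<kappa> x * ennreal (q v x)) \<partial>piX) = (\<integral>\<^sup>+ x. ennreal (q u x) * \<kappa> x \<partial>?N)"
    if "u \<in> space QU" for u
    using that v by (simp add: nn_integral_cond_out mult_ac)
  note sect = sections_sigma_finite[OF N.sigma_finite_measure_axioms sets \<kappa>]
  show "(\<lambda>u. \<integral>\<^sup>+ x. ennreal (q u x) * (\<kappa> x * ennreal (q v x)) \<partial>piX) \<in> borel_measurable QU"
    using sect(1) by (simp add: eq cong: measurable_cong)
  have "(\<integral>\<^sup>+ u. \<integral>\<^sup>+ x. ennreal (q u x) * (\<kappa> x * ennreal (q v x)) \<partial>piX \<partial>QU) = (\<integral>\<^sup>+ x. out x * \<kappa> x \<partial>?N)"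
    using sect(2) by (simp add: eq cong: nn_integral_cong)
  also have "\<dots> \<le> (\<integral>\<^sup>+ x. C \<partial>?N)"
  proof (rule nn_integral_mono_AE)
    have "AE x in piX. 0 < ennreal (q v x) \<longrightarrow> out x * \<kappa> x \<le> C"
      using out_finite_on_support[OF v] by eventually_elim (auto intro: le)
    then show "AE x in ?N. out x * \<kappa> x \<le> C"
      unfolding cond_out_def using v by (subst AE_density) auto
  qed
  also have "\<dots> = C" using emeasure_cond_out[OF v] by (simp add: space)
  finally show "(\<integral>\<^sup>+ u. \<integral>\<^sup>+ x. ennreal (q u x) * (\<kappa> x * ennreal (q v x)) \<partial>piX \<partial>QU) \<le> C" .
qed

text \<open>A choice of \<open>L\<close> that keeps \<open>out * \<kappa>\<close> bounded makes
  every pair term a collision integral covered by \<open>nn_integral_collision_le\<close>; the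
  single terms give the two information densities.\<close>

lemma expected_rel_ent_pos_le:
  fixes m :: nat and t \<alpha> :: real
  assumes m: "m \<ge> 1" and t: "t \<ge> 0"
  shows "(\<integral>\<^sup>+ c. rel_ent_pos piX (mix_dens q m c) \<partial>Pi\<^sub>M {..<m} (\<lambda>_. QU))
    \<le> ennreal t
      + (\<integral>\<^sup>+ u. \<integral>\<^sup>+ x. ennreal (max 0 (ln (q u x) - t - ln (real m / 2))) \<partial>cond_out piX q u \<partial>QU)
      + (\<integral>\<^sup>+ u. \<integral>\<^sup>+ x. ennreal (max 0 (ln (out_dens QU q x) - t + \<alpha>)) \<partial>cond_out piX q u \<partial>QU)
      + ennreal (2 * exp (- \<alpha>))"
proof -
  have out_dens: "out_dens QU q = (\<lambda>x. enn2real (out x))"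
    by (simp add: fun_eq_iff out_dens_def out_def)
  then have o_meas [measurable]: "out_dens QU q \<in> borel_measurable piX" by simp
  \<comment> \<open>The aim is that \<open>exp (L x)\<close> dominates
    \<open>out_dens QU q x * exp (\<alpha> - t)\<close>. As \<open>ln 0 = 0\<close>, the positive
    part could be nonzero where \<open>out_dens\<close> vanishes; the value 0 there provides the
    vanishing that the measurability of \<open>b\<close> rests on.\<close>
  define L where "L x = (if 0 < out_dens QU q x then max 0 (ln (out_dens QU q x) - t + \<alpha>) else 0)" for x
  define \<kappa> where "\<kappa> x = 2 * exp (- t) / (real m * exp (L x))" for x
  define A where "A u = (\<integral>\<^sup>+ x. ennreal (max 0 (ln (q u x) - t - ln (real m / 2))) \<partial>cond_out piX q u)" for u
  define B where "B u = (\<integral>\<^sup>+ x. ennreal (max 0 (ln (out_dens QU q x) - t + \<alpha>)) \<partial>cond_out piX q u)" for u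
  define b where "b u = (\<integral>\<^sup>+ x. ennreal (q u x) * ennreal (L x) \<partial>piX)" for u
  define r where "r u v = ennreal (1 / real m) *
    (\<integral>\<^sup>+ x. ennreal (q u x) * (ennreal (\<kappa> x) * ennreal (q v x)) \<partial>piX)" for u v
  \<comment> \<open>The bound on \<open>out * \<kappa>\<close>: \<open>2 / m\<close> comes from the
    slope and \<open>exp (- \<alpha>)\<close> from the choice of \<open>L\<close>.\<close>
  define C where "C = ennreal (2 * exp (- \<alpha>) / real m)"
  define a where "a u = ennreal (1 / real m) * (A u + (ennreal t + b u))" for u
  have [measurable]: "L \<in> borel_measurable piX" unfolding L_def by measurable
  have [measurable]: "\<kappa> \<in> borel_measurable piX" unfolding \<kappa>_def by measurable
  have L_nonneg: "L x \<ge> 0" for x by (simp add: L_def)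
  have \<kappa>_le: "out x * ennreal (\<kappa> x) \<le> C" if fin: "out x < \<infinity>" for x
  proof -
    let ?o = "out_dens QU q x"
    have o: "out x = ennreal ?o" "?o \<ge> 0" using fin by (simp_all add: out_dens)
    have "?o * exp (- t) \<le> exp (- \<alpha>) * exp (L x)"
    proof (cases "?o > 0")
      case True
      then have "?o * exp (- t) = exp (ln ?o - t)" by (simp add: exp_diff exp_minus field_simps)
      also have "\<dots> \<le> exp (- \<alpha> + L x)" using True by (simp add: L_def)
      finally show ?thesis unfolding exp_add .
    qed (use o in simp)
    then have "?o * \<kappa> x \<le> 2 * exp (- \<alpha>) / real m"
      using m by (simp add: \<kappa>_def field_simps)
    then show ?thesis
      using o by (simp add: C_def ennreal_mult'[symmetric] ennreal_leI)
  qed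
  note coll = nn_integral_collision_le[of _ "\<lambda>x. ennreal (\<kappa> x)" C, OF _ _ \<kappa>_le]
  have r_meas: "(\<lambda>u. r u v) \<in> borel_measurable QU" if "v \<in> space QU" for v
    unfolding r_def using coll(1)[OF that] by simp
  have r_le: "(\<integral>\<^sup>+ u. r u v \<partial>QU) \<le> ennreal (1 / real m) * C" if "v \<in> space QU" for v
    unfolding r_def using coll[OF that]
    by (subst nn_integral_cmult) (auto intro: mult_left_mono)
  have "(\<integral>\<^sup>+ c. rel_ent_pos piX (mix_dens q m c) \<partial>Pi\<^sub>M {..<m} (\<lambda>_. QU))
      \<le> 0 + of_nat (card {..<m}) * (\<integral>\<^sup>+ u. a u \<partial>QU)
        + of_nat (card {..<m} * (card {..<m} - 1)) * (ennreal (1 / real m) * C)"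
  proof (rule nn_integral_PiM_pairwise_le)
    show "r u v = r v u" for u v by (simp add: r_def mult_ac)
    show "rel_ent_pos piX (mix_dens q m c) \<le> 0 + (\<Sum>i<m. a (c i) + (\<Sum>j\<in>{..<m} - {i}. r (c i) (c j)))"
      if "c \<in> space (Pi\<^sub>M {..<m} (\<lambda>_. QU))" for c
      using rel_ent_mixture_le[OF m t _ L_nonneg that]
      by (simp add: a_def A_def b_def r_def \<kappa>_def)
  qed (auto intro: r_meas r_le)
  \<comment> \<open>There are \<open>m * (m - 1)\<close> ordered pairs, and the bound for each is
    \<open>2 * exp (- \<alpha>)\<close> divided by the square of \<open>m\<close>.\<close>
  also have "of_nat (card {..<m} * (card {..<m} - 1)) * (ennreal (1 / real m) * C) \<le> ennreal (2 * exp (- \<alpha>))"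
  proof -
    have "real (m * (m - 1)) * (1 / real m * (2 * exp (- \<alpha>) / real m)) \<le> 2 * exp (- \<alpha>)"
      using m by (simp add: field_simps)
    then show ?thesis
      by (simp add: C_def ennreal_of_nat_eq_real_of_nat ennreal_mult'[symmetric] ennreal_leI del: of_nat_mult)
  qed
  also have "of_nat (card {..<m}) * (\<integral>\<^sup>+ u. a u \<partial>QU)
    \<le> (\<integral>\<^sup>+ u. A u \<partial>QU) + (ennreal t + (\<integral>\<^sup>+ u. b u \<partial>QU))"
  proof -
    have b_meas [measurable]: "b \<in> borel_measurable QU"
      unfolding b_def by (rule borel_measurable_nn_integral_out) (auto simp: L_def out_dens)
    \<comment> \<open>Measurability of \<open>A\<close> is not established, so \<open>b\<close>
      plays the measurable summand.\<close>
    have "(\<integral>\<^sup>+ u. A u + (ennreal t + b u) \<partial>QU) \<le> (\<integral>\<^sup>+ u. A u \<partial>QU) + (\<integral>\<^sup>+ u. ennreal t + b u \<partial>QU)"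
      by (intro nn_integral_add_le) auto
    also have "(\<integral>\<^sup>+ u. ennreal t + b u \<partial>QU) = ennreal t + (\<integral>\<^sup>+ u. b u \<partial>QU)"
      by (subst nn_integral_add) (auto simp: emeasure_space_1)
    finally have sum_le: "(\<integral>\<^sup>+ u. A u + (ennreal t + b u) \<partial>QU)
      \<le> (\<integral>\<^sup>+ u. A u \<partial>QU) + (ennreal t + (\<integral>\<^sup>+ u. b u \<partial>QU))" .
    have "(\<integral>\<^sup>+ u. a u \<partial>QU) \<le> ennreal (1 / real m) * (\<integral>\<^sup>+ u. A u + (ennreal t + b u) \<partial>QU)"
      unfolding a_def using m by (intro nn_integral_cmult_le) simp
    also note mult_left_mono[OF sum_le zero_le]
    finally have "of_nat m * (\<integral>\<^sup>+ u. a u \<partial>QU)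
      \<le> of_nat m * (ennreal (1 / real m) * ((\<integral>\<^sup>+ u. A u \<partial>QU) + (ennreal t + (\<integral>\<^sup>+ u. b u \<partial>QU))))"
      by (rule mult_left_mono) simp
    moreover have "of_nat m * ennreal (1 / real m) = 1"
      using m by (simp add: ennreal_of_nat_eq_real_of_nat ennreal_mult'[symmetric])
    ultimately show ?thesis by (simp add: mult.assoc[symmetric])
  qed
  \<comment> \<open>Monotonicity holds for lower integrals, so the passage from \<open>b\<close>
    back to \<open>B\<close> asks for no measurability of \<open>B\<close>.\<close>
  also have "(\<integral>\<^sup>+ u. b u \<partial>QU) \<le> (\<integral>\<^sup>+ u. B u \<partial>QU)"
  proof (rule nn_integral_mono)
    fix u assume u: "u \<in> space QU"
    have "B u = (\<integral>\<^sup>+ x. ennreal (q u x) * ennreal (max 0 (ln (out_dens QU q x) - t + \<alpha>)) \<partial>piX)"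
      unfolding B_def using u by (intro nn_integral_cond_out) auto
    moreover have "ennreal (L x) \<le> ennreal (max 0 (ln (out_dens QU q x) - t + \<alpha>))" for x
      by (rule ennreal_leI) (simp add: L_def)
    ultimately show "b u \<le> B u"
      unfolding b_def by (simp only:) (intro nn_integral_mono mult_left_mono zero_le)
  qed
  finally show ?thesis
    by (simp add: A_def B_def add_ac add_left_mono add_right_mono)
qed

end

text \<open>The expected negative part of the relative entropy stands on the right-hand side, so
  that no difference of infinite quantities arises.\<close>

theorem mainTheorem14:
  fixes QU :: "'u measure" and piX :: "'x measure"
    and q :: "'u \<Rightarrow> 'x \<Rightarrow> real" and M :: nat
    and \<tau>0 \<alpha> \<beta> :: real
  assumes QU_prob: "prob_space QU"
    and q_meas: "(\<lambda>(u, x). q u x) \<in> borel_measurable (QU \<Otimes>\<^sub>M piX)"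
    and q_nonneg: "\<And>u x. u \<in> space QU \<Longrightarrow> x \<in> space piX \<Longrightarrow> 0 \<le> q u x"
    and q_prob: "\<And>u. u \<in> space QU \<Longrightarrow> (\<integral>\<^sup>+ x. ennreal (q u x) \<partial>piX) = 1"
    and M_pos: "M \<ge> 1"
    and tau0: "\<tau>0 \<ge> 0"
    and beta: "\<beta> > 1"
  shows "(\<integral>\<^sup>+ c. rel_ent_pos piX (mix_dens q M c) \<partial>(PiM {..<M} (\<lambda>_. QU)))
    \<le> ennreal \<tau>0
      + (\<integral>\<^sup>+ u. \<integral>\<^sup>+ x. ennreal (max 0 (ln (q u x) - \<tau>0 - ln (real M / 2))) \<partial>(cond_out piX q u) \<partial>QU)
      + ennreal \<beta> * (\<integral>\<^sup>+ u. \<integral>\<^sup>+ x. ennreal (max 0 (ln (out_dens QU q x) - \<tau>0 + \<alpha>)) \<partial>(cond_out piX q u) \<partial>QU)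
      + ennreal (2 * \<beta> / (\<beta> - 1) * exp (- \<alpha>))
      + (\<integral>\<^sup>+ c. rel_ent_neg piX (mix_dens q M c) \<partial>(PiM {..<M} (\<lambda>_. QU)))"
proof -
  interpret conditional_density QU piX q
    using assms by (simp add: conditional_density_def conditional_density_axioms_def)
  let ?A = "\<integral>\<^sup>+ u. \<integral>\<^sup>+ x. ennreal (max 0 (ln (q u x) - \<tau>0 - ln (real M / 2))) \<partial>(cond_out piX q u) \<partial>QU"
  let ?B = "\<integral>\<^sup>+ u. \<integral>\<^sup>+ x. ennreal (max 0 (ln (out_dens QU q x) - \<tau>0 + \<alpha>)) \<partial>(cond_out piX q u) \<partial>QU"
  \<comment> \<open>For \<open>\<beta> > 1\<close> both \<open>\<beta>\<close> and
    \<open>\<beta> / (\<beta> - 1)\<close> are at least 1, so the coefficients 1 and 2 of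
    \<open>expected_rel_ent_pos_le\<close> can be enlarged to the stated ones.\<close>
  have B: "?B \<le> ennreal \<beta> * ?B"
    using mult_right_mono[of 1 "ennreal \<beta>" ?B] beta by simp
  have "2 * exp (- \<alpha>) \<le> 2 * \<beta> / (\<beta> - 1) * exp (- \<alpha>)"
    using beta by (intro mult_right_mono) (auto simp: field_simps)
  then have C: "ennreal (2 * exp (- \<alpha>)) \<le> ennreal (2 * \<beta> / (\<beta> - 1) * exp (- \<alpha>))"
    by (rule ennreal_leI)
  have "(\<integral>\<^sup>+ c. rel_ent_pos piX (mix_dens q M c) \<partial>(PiM {..<M} (\<lambda>_. QU)))
    \<le> ennreal \<tau>0 + ?A + ?B + ennreal (2 * exp (- \<alpha>))"
    by (rule expected_rel_ent_pos_le[OF M_pos tau0])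
  also have "\<dots> \<le> ennreal \<tau>0 + ?A + ennreal \<beta> * ?B + ennreal (2 * \<beta> / (\<beta> - 1) * exp (- \<alpha>))"
    by (intro add_mono order_refl B C)
  also have "\<dots> \<le> \<dots> + (\<integral>\<^sup>+ c. rel_ent_neg piX (mix_dens q M c) \<partial>(PiM {..<M} (\<lambda>_. QU)))"
    by simp
  finally show ?thesis .
qed

end
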